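(* Let $\mathcal{E}:\mathrm{L}^2(X,m)\to[0,\infty]$ be a $2$-homogeneous nonlinear Dirichlet form, and let $$\Lambda^{\pm}(u,v):=\lim_{\sigma\to0^{\pm}}\frac{\mathcal{E}(u+\sigma v)-\mathcal{E}(u)}{\sigma},\qquad u,v\in D(\mathcal{E}).$$ Then the slopes $\Lambda^\pm$ have the following properties. 1. For all $u,v\in D(\mathcal{E})$, $\Lambda^\pm(u,v)$ are finite and $$|\Lambda^\pm(u,v)|\le 2\sqrt{\mathcal{E}(u)}\,\sqrt{\mathcal{E}(v)},$$ which is sharp for $u=v$ (equality holds when $u=v$). Moreover, $\Lambda^-(u,v)\le\Lambda^+(u,v)$ for all $u,v\in D(\mathcal{E})$. 2. For all $u\in D(\mathcal{E})$, $\Lambda^\pm(u,u)=2\mathcal{E}(u)$. 3. For all $u\in D(\mathcal{E})$, $\Lambda^\pm(u,\cdot)$ is positively $1$-homogeneous. Moreover, $\Lambda^+(u,\cdot)$ is convex, while $\Lambda^-(u,\cdot)$ is concave. 4. For all $v\in D(\mathcal{E})$, $\Lambda^\pm(\cdot,v)$ is positively $1$-homogeneous. 5. For all $u,v\in D(\mathcal{E})$, $\Lambda^+(u,-v)=-\Lambda^-(u,v)$. 6. If $\mathcal{E}$ is local and $u,v\in D(\mathcal{E})$ are such that $u$ is constant on $\mathrm{supp}(v)$, then $\Lambda^\pm(u,v)=0$.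
   Context: $(X,\mathcal{F},m)$ is a $\sigma$-finite measure space such that $\mathcal{F}$ is in bi-measurable correspondence with the Borel class on $\mathbb{R}$; $\mathrm{L}^2(X,m)$ is the real Hilbert space of square-integrable functions. For $\mathcal{E}:\mathrm{L}^2(X,m)\to[0,\infty]$, $D(\mathcal{E})=\{u:\mathcal{E}(u)\neq\infty\}$. $\mathcal{E}$ is $2$-homogeneous if $\mathcal{E}(\nu u)=\nu^2\mathcal{E}(u)$ for all $\nu\in\mathbb{R}$, $u\in\mathrm{L}^2(X,m)$ (convention $0\cdot\infty=0$). For such convex $\mathcal{E}$, $D(\mathcal{E})$ is a vector space and the one-sided limits defining $\Lambda^\pm$ exist by convexity of $\sigma\mapsto\mathcal{E}(u+\sigma v)$. Subdifferential: for $u\in D(\mathcal{E})$, $\partial\mathcal{E}(u)=\{\xi\in\mathrm{L}^2(X,m): \mathcal{E}(z)-\mathcal{E}(u)\ge\int_X\xi\,(z-u)\,dm \ \forall z\in\mathrm{L}^2(X,m)\}$. Nonlinear Dirichlet form: a convex, lower semicontinuous (in $\mathrm{L}^2$) functional $\mathcal{E}:\mathrm{L}^2(X,m)\to[0,\infty]$ with dense domain $D(\mathcal{E})$, whose gradient flow semigroup $(T_t)_{t\ge0}$ on $\mathrm{L}^2(X,m)$, i.e. the unique solution of $\partial_tT_tu\in-\partial\mathcal{E}(T_tu)$ for $t>0$, $T_0u=u$, satisfies: (i) contraction in all $\mathrm{L}^p$: $\|T_tu-T_tv\|_{\mathrm{L}^p}\le\|u-v\|_{\mathrm{L}^p}$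 for all $t\ge0$, $p\in[1,\infty]$, $u,v\in\mathrm{L}^2(X,m)$ (the right-hand side may be $+\infty$); (ii) order preservation: $u\ge v$ implies $T_tu\ge T_tv$ for all $t\ge0$, $u,v\in\mathrm{L}^2(X,m)$. A functional $F$ is positively $1$-homogeneous if $F(\lambda w)=\lambda F(w)$ for all $\lambda>0$. $\mathcal{E}$ is local if for all $u,v\in D(\mathcal{E})$ such that $u$ is constant on the support of $v$, $\mathcal{E}(u+v)=\mathcal{E}(u)+\mathcal{E}(v)$. Here the support $\mathrm{supp}(v)$ of $v$ is understood as $\{v\neq0\}$, up to $m$-null sets. *)

theory Defs
  imports "HOL-Probability.Essential_Supremum"
begin

text \<open>
  Elements of \<open>L\<^sup>2(X,m)\<close> are represented by square-integrable functions. A functional on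
  \<open>L\<^sup>2(X,m)\<close> is a function on representatives that respects almost-everywhere equality
  (\<open>L2_functional\<close>); its values on functions outside \<open>L2_space\<close> are irrelevant.
\<close>

definition L2_space :: "'a measure \<Rightarrow> ('a \<Rightarrow> real) set" where
  "L2_space M = {u \<in> borel_measurable M. integrable M (\<lambda>x. (u x)\<^sup>2)}"

definition L2_norm :: "'a measure \<Rightarrow> ('a \<Rightarrow> real) \<Rightarrow> real" where
  "L2_norm M u = sqrt (LINT x|M. (u x)\<^sup>2)"

definition Lp_norm :: "'a measure \<Rightarrow> ennreal \<Rightarrow> ('a \<Rightarrow> real) \<Rightarrow> ennreal" where
  "Lp_norm M p u =
    (if p = \<infinity> then esssup M (\<lambda>x. ennreal \<bar>u x\<bar>)
     else let I = (\<integral>\<^sup>+ x. ennreal (\<bar>u x\<bar> powr enn2real p) \<partial>M)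
          in if I = \<infinity> then \<infinity> else ennreal (enn2real I powr (1 / enn2real p)))"

definition borel_correspondence :: "'a measure \<Rightarrow> bool" where
  "borel_correspondence M \<longleftrightarrow>
    (\<exists>f g. f \<in> measurable M (borel :: real measure) \<and> g \<in> measurable borel M \<and>
           (\<forall>x\<in>space M. g (f x) = x) \<and> (\<forall>y. f (g y) = y))"

definition L2_functional :: "'a measure \<Rightarrow> (('a \<Rightarrow> real) \<Rightarrow> ennreal) \<Rightarrow> bool" where
  "L2_functional M E \<longleftrightarrow>
    (\<forall>u\<in>L2_space M. \<forall>v\<in>L2_space M. (AE x in M. u x = v x) \<longrightarrow> E u = E v)"

definition eff_domain :: "'a measure \<Rightarrow> (('a \<Rightarrow> real) \<Rightarrow> ennreal) \<Rightarrow> ('a \<Rightarrow> real) set" where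
  "eff_domain M E = {u \<in> L2_space M. E u \<noteq> \<infinity>}"

definition convex_functional :: "'a measure \<Rightarrow> (('a \<Rightarrow> real) \<Rightarrow> ennreal) \<Rightarrow> bool" where
  "convex_functional M E \<longleftrightarrow>
    (\<forall>u\<in>L2_space M. \<forall>v\<in>L2_space M. \<forall>s\<in>{0..1::real}.
       E (\<lambda>x. (1 - s) * u x + s * v x) \<le> ennreal (1 - s) * E u + ennreal s * E v)"

definition L2_lsc :: "'a measure \<Rightarrow> (('a \<Rightarrow> real) \<Rightarrow> ennreal) \<Rightarrow> bool" where
  "L2_lsc M E \<longleftrightarrow>
    (\<forall>u\<in>L2_space M. \<forall>w. (\<forall>n::nat. w n \<in> L2_space M) \<longrightarrow>
       (\<lambda>n. L2_norm M (\<lambda>x. w n x - u x)) \<longlonglongrightarrow> 0 \<longrightarrow> E u \<le> liminf (\<lambda>n. E (w n)))"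

definition densely_defined :: "'a measure \<Rightarrow> (('a \<Rightarrow> real) \<Rightarrow> ennreal) \<Rightarrow> bool" where
  "densely_defined M E \<longleftrightarrow>
    (\<forall>u\<in>L2_space M. \<forall>e>0. \<exists>v\<in>eff_domain M E. L2_norm M (\<lambda>x. u x - v x) < e)"

definition two_homogeneous :: "'a measure \<Rightarrow> (('a \<Rightarrow> real) \<Rightarrow> ennreal) \<Rightarrow> bool" where
  "two_homogeneous M E \<longleftrightarrow>
    (\<forall>c::real. \<forall>u\<in>L2_space M. E (\<lambda>x. c * u x) = ennreal (c\<^sup>2) * E u)"

text \<open>Empty when \<open>u\<close> lies outside the effective domain.\<close>

definition subdifferential ::
  "'a measure \<Rightarrow> (('a \<Rightarrow> real) \<Rightarrow> ennreal) \<Rightarrow> ('a \<Rightarrow> real) \<Rightarrow> ('a \<Rightarrow> real) set" where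
  "subdifferential M E u =
    {\<xi> \<in> L2_space M. u \<in> eff_domain M E \<and>
       (\<forall>z\<in>L2_space M. enn2ereal (E z) - enn2ereal (E u) \<ge>
          ereal (LINT x|M. \<xi> x * (z x - u x)))}"

definition has_L2_derivative ::
  "'a measure \<Rightarrow> (real \<Rightarrow> 'a \<Rightarrow> real) \<Rightarrow> ('a \<Rightarrow> real) \<Rightarrow> real \<Rightarrow> bool" where
  "has_L2_derivative M y \<eta> t \<longleftrightarrow>
    ((\<lambda>h. L2_norm M (\<lambda>x. (y (t + h) x - y t x) / h - \<eta> x)) \<longlongrightarrow> 0) (at 0)"

text \<open>
  Solutions are understood in the sense of Brezis: continuous on \<open>[0,\<infinity>)\<close>, locally absolutely
  continuous on \<open>(0,\<infinity>)\<close>, with the differential inclusion at almost every \<open>t > 0\<close> (a two-sided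
  derivative need not exist at every \<open>t > 0\<close>).
\<close>

definition gradient_flow_curve ::
  "'a measure \<Rightarrow> (('a \<Rightarrow> real) \<Rightarrow> ennreal) \<Rightarrow> ('a \<Rightarrow> real) \<Rightarrow> (real \<Rightarrow> 'a \<Rightarrow> real) \<Rightarrow> bool" where
  "gradient_flow_curve M E u y \<longleftrightarrow>
    (\<forall>t\<ge>0. y t \<in> L2_space M) \<and>
    (AE x in M. y 0 x = u x) \<and>
    (\<forall>t\<ge>0. ((\<lambda>s. L2_norm M (\<lambda>x. y s x - y t x)) \<longlongrightarrow> 0) (at t within {0..})) \<and>
    (\<forall>a>0. \<forall>b\<ge>a. \<exists>g. set_integrable lborel {a..b} g \<and>
       (\<forall>s t. a \<le> s \<and> s \<le> t \<and> t \<le> b \<longrightarrow>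
          L2_norm M (\<lambda>x. y t x - y s x) \<le> (LINT r:{s..t}|lborel. g r))) \<and>
    (AE t in lborel. 0 < t \<longrightarrow>
       (\<exists>\<xi>\<in>subdifferential M E (y t). has_L2_derivative M y (\<lambda>x. - \<xi> x) t))"

definition gradient_flow_semigroup ::
  "'a measure \<Rightarrow> (('a \<Rightarrow> real) \<Rightarrow> ennreal) \<Rightarrow> (real \<Rightarrow> ('a \<Rightarrow> real) \<Rightarrow> 'a \<Rightarrow> real) \<Rightarrow> bool" where
  "gradient_flow_semigroup M E T \<longleftrightarrow>
    (\<forall>u\<in>L2_space M. gradient_flow_curve M E u (\<lambda>t. T t u) \<and>
       (\<forall>y. gradient_flow_curve M E u y \<longrightarrow> (\<forall>t\<ge>0. AE x in M. y t x = T t u x)))"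

text \<open>
  For convex, lower semicontinuous, densely defined \<open>E\<close> the semigroup exists and is unique up to
  null sets (Brezis, Komura), so the existential quantifier only names it.
\<close>

definition nonlinear_dirichlet_form :: "'a measure \<Rightarrow> (('a \<Rightarrow> real) \<Rightarrow> ennreal) \<Rightarrow> bool" where
  "nonlinear_dirichlet_form M E \<longleftrightarrow>
    L2_functional M E \<and> convex_functional M E \<and> L2_lsc M E \<and> densely_defined M E \<and>
    (\<exists>T. gradient_flow_semigroup M E T \<and>
       (\<forall>t\<ge>0. \<forall>p\<ge>1. \<forall>u\<in>L2_space M. \<forall>v\<in>L2_space M.
          Lp_norm M p (\<lambda>x. T t u x - T t v x) \<le> Lp_norm M p (\<lambda>x. u x - v x)) \<and>
       (\<forall>t\<ge>0. \<forall>u\<in>L2_space M. \<forall>v\<in>L2_space M.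
          (AE x in M. v x \<le> u x) \<longrightarrow> (AE x in M. T t v x \<le> T t u x)))"

definition diff_quotient ::
  "(('a \<Rightarrow> real) \<Rightarrow> ennreal) \<Rightarrow> ('a \<Rightarrow> real) \<Rightarrow> ('a \<Rightarrow> real) \<Rightarrow> real \<Rightarrow> ereal" where
  "diff_quotient E u v \<sigma> =
    (enn2ereal (E (\<lambda>x. u x + \<sigma> * v x)) - enn2ereal (E u)) / ereal \<sigma>"

definition slope_plus ::
  "(('a \<Rightarrow> real) \<Rightarrow> ennreal) \<Rightarrow> ('a \<Rightarrow> real) \<Rightarrow> ('a \<Rightarrow> real) \<Rightarrow> ereal" where
  "slope_plus E u v = Lim (at_right 0) (diff_quotient E u v)"

definition slope_minus ::
  "(('a \<Rightarrow> real) \<Rightarrow> ennreal) \<Rightarrow> ('a \<Rightarrow> real) \<Rightarrow> ('a \<Rightarrow> real) \<Rightarrow> ereal" where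
  "slope_minus E u v = Lim (at_left 0) (diff_quotient E u v)"

definition pos_homogeneous_on :: "('a \<Rightarrow> real) set \<Rightarrow> (('a \<Rightarrow> real) \<Rightarrow> ereal) \<Rightarrow> bool" where
  "pos_homogeneous_on D F \<longleftrightarrow>
    (\<forall>w\<in>D. \<forall>c>0. F (\<lambda>x. c * w x) = ereal c * F w)"

definition ereal_convex_on :: "('a \<Rightarrow> real) set \<Rightarrow> (('a \<Rightarrow> real) \<Rightarrow> ereal) \<Rightarrow> bool" where
  "ereal_convex_on D F \<longleftrightarrow>
    (\<forall>v\<in>D. \<forall>w\<in>D. \<forall>s\<in>{0..1::real}.
       F (\<lambda>x. (1 - s) * v x + s * w x) \<le> ereal (1 - s) * F v + ereal s * F w)"

definition ereal_concave_on :: "('a \<Rightarrow> real) set \<Rightarrow> (('a \<Rightarrow> real) \<Rightarrow> ereal) \<Rightarrow> bool" where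
  "ereal_concave_on D F \<longleftrightarrow>
    (\<forall>v\<in>D. \<forall>w\<in>D. \<forall>s\<in>{0..1::real}.
       F (\<lambda>x. (1 - s) * v x + s * w x) \<ge> ereal (1 - s) * F v + ereal s * F w)"

definition constant_on_supp :: "'a measure \<Rightarrow> ('a \<Rightarrow> real) \<Rightarrow> ('a \<Rightarrow> real) \<Rightarrow> bool" where
  "constant_on_supp M u v \<longleftrightarrow> (\<exists>c. AE x in M. v x \<noteq> 0 \<longrightarrow> u x = c)"

definition local_functional :: "'a measure \<Rightarrow> (('a \<Rightarrow> real) \<Rightarrow> ennreal) \<Rightarrow> bool" where
  "local_functional M E \<longleftrightarrow>
    (\<forall>u\<in>eff_domain M E. \<forall>v\<in>eff_domain M E. constant_on_supp M u v \<longrightarrow>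
       E (\<lambda>x. u x + v x) = E u + E v)"

end

theory Submission
  imports Defs
begin

text \<open>
  On its effective domain, which convexity and 2-homogeneity make a linear subspace, \<open>E\<close> is a
  finite convex function \<open>f\<close> with \<open>f (c u) = c\<^sup>2 f u\<close>. Hence \<open>\<surd>f\<close> is the gauge of the convex
  symmetric set \<open>{f \<le> 1}\<close>, that is, a seminorm (lemma \<open>sqrt_triangle\<close>), and squaring the triangle
  inequality gives, for \<open>\<sigma> > 0\<close>,

    \<open>- 2 \<sigma> \<surd>f(u) \<surd>f(v) \<le> f (u + \<sigma> v) - f u \<le> 2 \<sigma> \<surd>f(u) \<surd>f(v) + \<sigma>\<^sup>2 f v\<close>

  (lemmas \<open>quot_lower\<close> and \<open>quot_upper\<close>). Division by \<open>\<sigma>\<close> and the limit \<open>\<sigma> \<rightarrow> 0\<close> turn this into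
  the Cauchy--Schwarz bound for the slopes. The limit exists because the difference quotients of a
  convex function increase in \<open>\<sigma>\<close> and are, by the same estimate, bounded below.

  The remaining properties hold for the quotients or follow from a substitution in \<open>\<sigma>\<close>, and are
  inherited by the limit. Since replacing \<open>\<sigma>\<close> by \<open>-\<sigma>\<close> amounts to replacing \<open>v\<close> by \<open>-v\<close>, the
  left slope in direction \<open>v\<close> is minus the right slope in direction \<open>-v\<close>, so that it suffices to
  study right slopes.
\<close>

section \<open>Right slopes of convex 2-homogeneous functions\<close>

lemma tendsto_at_right_mono_bounded:
  fixes q :: "real \<Rightarrow> real"
  assumes mono: "\<And>s t. a < s \<Longrightarrow> s \<le> t \<Longrightarrow> q s \<le> q t"
    and bdd: "\<And>s. a < s \<Longrightarrow> B \<le> q s"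
  shows "(q \<longlongrightarrow> (INF s\<in>{a<..}. q s)) (at_right a)"
proof (rule order_tendstoI)
  have below: "bdd_below (q ` {a<..})"
    using bdd by (intro bdd_belowI2[where m = B]) auto
  fix c assume c: "c < (INF s\<in>{a<..}. q s)"
  have "c < q s" if "a < s" for s
    using cINF_lower[OF below, of s] that c by auto
  then show "\<forall>\<^sub>F s in at_right a. c < q s"
    by (auto simp: eventually_at_filter)
next
  fix c assume "(INF s\<in>{a<..}. q s) < c"
  then obtain t where t: "a < t" "q t < c"
    using cInf_lessD[of "q ` {a<..}" c] by (auto simp: greaterThan_non_empty)
  have "q s < c" if "a < s" "s < t" for s
    using mono[of s t] that t by simp
  then show "\<forall>\<^sub>F s in at_right a. q s < c"
    using eventually_at_right[OF t(1)] t(1) by blast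
qed

lemma tendsto_at_right_0_rescale:
  fixes g :: "real \<Rightarrow> 'b::topological_space"
  assumes "(g \<longlongrightarrow> L) (at_right 0)" "0 < c"
  shows "((\<lambda>\<sigma>. g (c * \<sigma>)) \<longlongrightarrow> L) (at_right 0)"
proof -
  have "((\<lambda>\<sigma>. c * \<sigma>) \<longlongrightarrow> c * 0) (at_right 0)"
    by (intro tendsto_intros)
  then have "filterlim (\<lambda>\<sigma>. c * \<sigma>) (at_right 0) (at_right 0)"
    using assms(2) by (auto simp: filterlim_at eventually_at_filter)
  with assms(1) show ?thesis by (rule filterlim_compose)
qed

text \<open>
  A linear subspace \<open>D\<close> of functions carrying a nonnegative convex 2-homogeneous \<open>f\<close>. The vector
  operations are pointwise expressions, in the form in which difference quotients of functionals
  contain them.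
\<close>

locale convex_two_homogeneous =
  fixes D :: "('a \<Rightarrow> real) set" and f :: "('a \<Rightarrow> real) \<Rightarrow> real"
  assumes add_mem: "u \<in> D \<Longrightarrow> v \<in> D \<Longrightarrow> (\<lambda>x. u x + v x) \<in> D"
    and scale_mem: "u \<in> D \<Longrightarrow> (\<lambda>x. c * u x) \<in> D"
    and nonneg: "0 \<le> f u"
    and hom: "u \<in> D \<Longrightarrow> f (\<lambda>x. c * u x) = c\<^sup>2 * f u"
    and convex: "u \<in> D \<Longrightarrow> v \<in> D \<Longrightarrow> 0 \<le> s \<Longrightarrow> s \<le> 1 \<Longrightarrow>
      f (\<lambda>x. (1 - s) * u x + s * v x) \<le> (1 - s) * f u + s * f v"
begin

definition quot :: "('a \<Rightarrow> real) \<Rightarrow> ('a \<Rightarrow> real) \<Rightarrow> real \<Rightarrow> real" where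
  "quot u v \<sigma> = (f (\<lambda>x. u x + \<sigma> * v x) - f u) / \<sigma>"

text \<open>
  The quotients increase in \<open>\<sigma>\<close>, so their infimum over \<open>\<sigma> > 0\<close> is their limit at 0 from the right
  (lemma \<open>quot_tendsto\<close>).
\<close>

definition right_slope :: "('a \<Rightarrow> real) \<Rightarrow> ('a \<Rightarrow> real) \<Rightarrow> real" where
  "right_slope u v = (INF \<sigma>\<in>{0<..}. quot u v \<sigma>)"

lemma line_mem: "u \<in> D \<Longrightarrow> v \<in> D \<Longrightarrow> (\<lambda>x. u x + \<sigma> * v x) \<in> D"
  by (intro add_mem scale_mem)

lemma uminus_mem: "u \<in> D \<Longrightarrow> (\<lambda>x. - u x) \<in> D"
  using scale_mem[of u "-1"] by simp

lemma f_uminus: "u \<in> D \<Longrightarrow> f (\<lambda>x. - u x) = f u"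
  using hom[of u "-1"] by simp

lemma sqrt_hom: "u \<in> D \<Longrightarrow> sqrt (f (\<lambda>x. c * u x)) = \<bar>c\<bar> * sqrt (f u)"
  by (simp add: hom real_sqrt_mult)

text \<open>
  The gauge argument: for \<open>a > \<surd>f(u)\<close> and \<open>b > \<surd>f(v)\<close>, the vector \<open>(u + v) / (a + b)\<close> is a convex
  combination of \<open>u / a\<close> and \<open>v / b\<close>, both of which lie in the convex set \<open>{f \<le> 1}\<close>.
\<close>

lemma sqrt_triangle:
  assumes u: "u \<in> D" and v: "v \<in> D"
  shows "sqrt (f (\<lambda>x. u x + v x)) \<le> sqrt (f u) + sqrt (f v)"
proof (rule field_le_epsilon)
  fix e :: real assume e: "0 < e"
  define a where "a = sqrt (f u) + e / 2"
  define b where "b = sqrt (f v) + e / 2"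
  have a: "0 < a" and b: "0 < b"
    using e nonneg[of u] nonneg[of v] by (auto simp: a_def b_def add_nonneg_pos)
  have unit: "f (\<lambda>x. (1 / c) * w x) \<le> 1" if "w \<in> D" "0 < c" "sqrt (f w) \<le> c" for w c
  proof -
    have "f w \<le> c\<^sup>2"
      using that(3) nonneg[of w] by (metis real_sqrt_le_iff real_sqrt_abs abs_of_pos that(2))
    then show ?thesis
      using that hom[of w "1 / c"] by (simp add: power_divide)
  qed
  define s where "s = b / (a + b)"
  have s: "0 \<le> s" "s \<le> 1" "1 - s = a / (a + b)"
    using a b by (auto simp: s_def field_simps)
  have "(\<lambda>x. (1 / (a + b)) * (u x + v x)) =
      (\<lambda>x. (1 - s) * ((1 / a) * u x) + s * ((1 / b) * v x))"
    using a b unfolding s(3) by (auto simp: s_def add_divide_distrib)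
  then have "f (\<lambda>x. (1 / (a + b)) * (u x + v x)) \<le>
      (1 - s) * f (\<lambda>x. (1 / a) * u x) + s * f (\<lambda>x. (1 / b) * v x)"
    using convex[OF scale_mem[OF u] scale_mem[OF v] s(1,2), of "1 / a" "1 / b"] by simp
  also have "\<dots> \<le> (1 - s) * 1 + s * 1"
    using unit[OF u a] unit[OF v b] s e
    by (intro add_mono mult_left_mono) (auto simp: a_def b_def)
  finally have "f (\<lambda>x. u x + v x) / (a + b)\<^sup>2 \<le> 1"
    by (simp add: hom[OF add_mem[OF u v], of "1 / (a + b)", simplified] power_divide)
  then have "f (\<lambda>x. u x + v x) \<le> (a + b)\<^sup>2"
    using a b by (simp add: divide_le_eq)
  then have "sqrt (f (\<lambda>x. u x + v x)) \<le> a + b"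
    using a b by (intro real_le_lsqrt) auto
  then show "sqrt (f (\<lambda>x. u x + v x)) \<le> sqrt (f u) + sqrt (f v) + e"
    by (simp add: a_def b_def)
qed

lemma quot_upper:
  assumes "u \<in> D" "v \<in> D" "0 < \<sigma>"
  shows "quot u v \<sigma> \<le> 2 * sqrt (f u) * sqrt (f v) + \<sigma> * f v"
proof -
  let ?w = "\<lambda>x. u x + \<sigma> * v x"
  have "sqrt (f ?w) \<le> sqrt (f u) + \<sigma> * sqrt (f v)"
    using sqrt_triangle[OF assms(1) scale_mem[OF assms(2)], of \<sigma>] assms by (simp add: sqrt_hom)
  then have "(sqrt (f ?w))\<^sup>2 \<le> (sqrt (f u) + \<sigma> * sqrt (f v))\<^sup>2"
    by (intro power_mono) (auto simp: nonneg)
  then have "f ?w \<le> f u + 2 * \<sigma> * sqrt (f u) * sqrt (f v) + \<sigma>\<^sup>2 * f v"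
    by (simp add: nonneg power2_sum power_mult_distrib mult_ac)
  then have "f ?w - f u \<le> (2 * sqrt (f u) * sqrt (f v) + \<sigma> * f v) * \<sigma>"
    by (simp add: algebra_simps power2_eq_square)
  then show ?thesis
    unfolding quot_def using assms(3) by (subst pos_divide_le_eq)
qed

lemma quot_lower:
  assumes "u \<in> D" "v \<in> D" "0 < \<sigma>"
  shows "- (2 * sqrt (f u) * sqrt (f v)) \<le> quot u v \<sigma>"
proof -
  let ?w = "\<lambda>x. u x + \<sigma> * v x"
  let ?a = "sqrt (f u)" and ?b = "\<sigma> * sqrt (f v)"
  have b: "0 \<le> ?b" using assms(3) nonneg[of v] by simp
  have tri: "?a \<le> sqrt (f ?w) + ?b"
    using sqrt_triangle[OF line_mem[OF assms(1,2), of \<sigma>] scale_mem[OF assms(2)], of "- \<sigma>"] assms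
    by (simp add: f_uminus scale_mem sqrt_hom)
  have "?a\<^sup>2 - 2 * ?a * ?b \<le> (sqrt (f ?w))\<^sup>2"
  proof (cases "?a \<le> ?b")
    \<comment> \<open>In this case the reverse triangle inequality is void, but the left-hand side is at
      most 0.\<close>
    case True
    then have "?a * ?a \<le> ?a * ?b"
      by (intro mult_left_mono) (auto simp: nonneg)
    moreover have "0 \<le> ?a * ?b"
      by (rule mult_nonneg_nonneg[OF _ b]) (simp add: nonneg)
    ultimately have "?a\<^sup>2 - 2 * ?a * ?b \<le> 0"
      unfolding power2_eq_square by linarith
    also have "0 \<le> (sqrt (f ?w))\<^sup>2" by simp
    finally show ?thesis .
  next
    case False
    then have "(?a - ?b)\<^sup>2 \<le> (sqrt (f ?w))\<^sup>2"
      using tri by (intro power_mono) auto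
    moreover have "(?a - ?b)\<^sup>2 = ?a\<^sup>2 - 2 * ?a * ?b + ?b\<^sup>2"
      by (rule power2_diff[THEN trans]) linarith
    moreover have "0 \<le> ?b\<^sup>2" by simp
    ultimately show ?thesis by linarith
  qed
  then have "- (2 * sqrt (f u) * sqrt (f v)) * \<sigma> \<le> f ?w - f u"
    by (simp add: nonneg algebra_simps)
  then show ?thesis
    unfolding quot_def using assms(3) by (subst pos_le_divide_eq)
qed

lemma quot_mono:
  assumes "u \<in> D" "v \<in> D" "0 < \<sigma>" "\<sigma> \<le> \<tau>"
  shows "quot u v \<sigma> \<le> quot u v \<tau>"
proof -
  have r: "0 \<le> \<sigma> / \<tau>" "\<sigma> / \<tau> \<le> 1" using assms by auto
  have "(\<lambda>x. (1 - \<sigma> / \<tau>) * u x + (\<sigma> / \<tau>) * (u x + \<tau> * v x)) = (\<lambda>x. u x + \<sigma> * v x)"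
    using assms by (auto simp: field_simps)
  then have "f (\<lambda>x. u x + \<sigma> * v x) \<le>
      (1 - \<sigma> / \<tau>) * f u + (\<sigma> / \<tau>) * f (\<lambda>x. u x + \<tau> * v x)"
    using convex[OF assms(1) line_mem[OF assms(1,2), of \<tau>] r] by simp
  then have "f (\<lambda>x. u x + \<sigma> * v x) - f u \<le> quot u v \<tau> * \<sigma>"
    using assms by (simp add: quot_def algebra_simps diff_divide_distrib)
  then show ?thesis
    unfolding quot_def[of u v \<sigma>] using assms(3) by (subst pos_divide_le_eq)
qed

lemma quot_tendsto:
  assumes "u \<in> D" "v \<in> D"
  shows "(quot u v \<longlongrightarrow> right_slope u v) (at_right 0)"
  unfolding right_slope_def
  by (rule tendsto_at_right_mono_bounded) (use assms quot_mono quot_lower in blast)+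

lemma right_slope_eqI:
  assumes "u \<in> D" "v \<in> D" "(g \<longlongrightarrow> L) (at_right 0)"
    and "\<And>\<sigma>. 0 < \<sigma> \<Longrightarrow> quot u v \<sigma> = g \<sigma>"
  shows "right_slope u v = L"
proof -
  have "(quot u v \<longlongrightarrow> L) (at_right 0)"
    using assms(3) by (rule Lim_transform_eventually) (auto simp: eventually_at_filter assms(4))
  then show ?thesis
    using tendsto_unique[OF _ quot_tendsto[OF assms(1,2)]] by simp
qed

lemma abs_right_slope_le:
  assumes "u \<in> D" "v \<in> D"
  shows "\<bar>right_slope u v\<bar> \<le> 2 * sqrt (f u) * sqrt (f v)"
proof -
  have "- (2 * sqrt (f u) * sqrt (f v)) \<le> right_slope u v"
    by (rule tendsto_lowerbound[OF quot_tendsto[OF assms]])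
       (auto simp: eventually_at_filter intro!: always_eventually quot_lower[OF assms])
  moreover have "right_slope u v \<le> 2 * sqrt (f u) * sqrt (f v)"
  proof (rule tendsto_le[OF _ _ quot_tendsto[OF assms]])
    have "((\<lambda>\<sigma>. 2 * sqrt (f u) * sqrt (f v) + \<sigma> * f v) \<longlongrightarrow>
        2 * sqrt (f u) * sqrt (f v) + 0 * f v) (at_right 0)"
      by (intro tendsto_intros)
    then show "((\<lambda>\<sigma>. 2 * sqrt (f u) * sqrt (f v) + \<sigma> * f v) \<longlongrightarrow>
        2 * sqrt (f u) * sqrt (f v)) (at_right 0)" by simp
  qed (auto simp: eventually_at_filter intro!: always_eventually quot_upper[OF assms])
  ultimately show ?thesis by linarith
qed

lemma right_slope_self: "u \<in> D \<Longrightarrow> right_slope u u = 2 * f u"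
proof (rule right_slope_eqI)
  assume u: "u \<in> D"
  fix \<sigma> :: real assume "0 < \<sigma>"
  have "f (\<lambda>x. u x + \<sigma> * u x) = (1 + \<sigma>)\<^sup>2 * f u"
    using hom[OF u, of "1 + \<sigma>"] by (simp add: algebra_simps)
  with \<open>0 < \<sigma>\<close> show "quot u u \<sigma> = (2 + \<sigma>) * f u"
    by (simp add: quot_def field_simps power2_eq_square)
next
  have "((\<lambda>\<sigma>. (2 + \<sigma>) * f u) \<longlongrightarrow> (2 + 0) * f u) (at_right 0)"
    by (intro tendsto_intros)
  then show "((\<lambda>\<sigma>. (2 + \<sigma>) * f u) \<longlongrightarrow> 2 * f u) (at_right 0)" by simp
qed

lemma right_slope_uminus_self: "u \<in> D \<Longrightarrow> right_slope u (\<lambda>x. - u x) = - 2 * f u"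
proof (rule right_slope_eqI)
  assume u: "u \<in> D"
  then show "(\<lambda>x. - u x) \<in> D" by (rule uminus_mem)
  fix \<sigma> :: real assume "0 < \<sigma>"
  have "f (\<lambda>x. u x + \<sigma> * (- u x)) = (1 - \<sigma>)\<^sup>2 * f u"
    using hom[OF u, of "1 - \<sigma>"] by (simp add: algebra_simps)
  with \<open>0 < \<sigma>\<close> show "quot u (\<lambda>x. - u x) \<sigma> = (\<sigma> - 2) * f u"
    by (simp add: quot_def field_simps power2_eq_square)
next
  have "((\<lambda>\<sigma>. (\<sigma> - 2) * f u) \<longlongrightarrow> (0 - 2) * f u) (at_right 0)"
    by (intro tendsto_intros)
  then show "((\<lambda>\<sigma>. (\<sigma> - 2) * f u) \<longlongrightarrow> - 2 * f u) (at_right 0)" by simp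
qed

lemma right_slope_scale_direction:
  assumes "u \<in> D" "v \<in> D" "0 < c"
  shows "right_slope u (\<lambda>x. c * v x) = c * right_slope u v"
proof (rule right_slope_eqI)
  show "((\<lambda>\<sigma>. c * quot u v (c * \<sigma>)) \<longlongrightarrow> c * right_slope u v) (at_right 0)"
    by (intro tendsto_mult_left tendsto_at_right_0_rescale quot_tendsto assms)
  show "quot u (\<lambda>x. c * v x) \<sigma> = c * quot u v (c * \<sigma>)" for \<sigma>
    using assms(3) by (simp add: quot_def mult_ac)
qed (use assms scale_mem in auto)

text \<open>
  By 2-homogeneity \<open>f (c u + \<sigma> v) = c\<^sup>2 f (u + (\<sigma> / c) v)\<close>; one of the two factors \<open>c\<close> is absorbed
  by the change of variable \<open>\<sigma> / c\<close> in the denominator.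
\<close>

lemma right_slope_scale_point:
  assumes "u \<in> D" "v \<in> D" "0 < c"
  shows "right_slope (\<lambda>x. c * u x) v = c * right_slope u v"
proof (rule right_slope_eqI)
  show "((\<lambda>\<sigma>. c * quot u v ((1 / c) * \<sigma>)) \<longlongrightarrow> c * right_slope u v) (at_right 0)"
    using assms by (intro tendsto_mult_left tendsto_at_right_0_rescale quot_tendsto) auto
  show "quot (\<lambda>x. c * u x) v \<sigma> = c * quot u v ((1 / c) * \<sigma>)" if "0 < \<sigma>" for \<sigma>
  proof -
    have "f (\<lambda>x. c * u x + \<sigma> * v x) = c\<^sup>2 * f (\<lambda>x. u x + ((1 / c) * \<sigma>) * v x)"
      using hom[OF line_mem[OF assms(1,2)], of c "(1 / c) * \<sigma>"] assms(3)
      by (simp add: algebra_simps)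
    then show ?thesis
      using assms that by (simp add: quot_def hom field_simps power2_eq_square)
  qed
qed (use assms scale_mem in auto)

lemma right_slope_convex:
  assumes "u \<in> D" "v \<in> D" "w \<in> D" "0 \<le> s" "s \<le> 1"
  shows "right_slope u (\<lambda>x. (1 - s) * v x + s * w x) \<le>
    (1 - s) * right_slope u v + s * right_slope u w"
proof (rule tendsto_le)
  show "((\<lambda>\<sigma>. (1 - s) * quot u v \<sigma> + s * quot u w \<sigma>) \<longlongrightarrow>
      (1 - s) * right_slope u v + s * right_slope u w) (at_right 0)"
    by (intro tendsto_intros quot_tendsto assms)
  show "(quot u (\<lambda>x. (1 - s) * v x + s * w x) \<longlongrightarrow>
      right_slope u (\<lambda>x. (1 - s) * v x + s * w x)) (at_right 0)"
    by (intro quot_tendsto assms add_mem scale_mem)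
  have "quot u (\<lambda>x. (1 - s) * v x + s * w x) \<sigma> \<le> (1 - s) * quot u v \<sigma> + s * quot u w \<sigma>"
    if "0 < \<sigma>" for \<sigma>
  proof -
    have "(\<lambda>x. u x + \<sigma> * ((1 - s) * v x + s * w x)) =
        (\<lambda>x. (1 - s) * (u x + \<sigma> * v x) + s * (u x + \<sigma> * w x))"
      by (auto simp: algebra_simps)
    then have "f (\<lambda>x. u x + \<sigma> * ((1 - s) * v x + s * w x)) - f u \<le>
        (1 - s) * (f (\<lambda>x. u x + \<sigma> * v x) - f u) + s * (f (\<lambda>x. u x + \<sigma> * w x) - f u)"
      using convex[OF line_mem[OF assms(1,2)] line_mem[OF assms(1,3)] assms(4,5), of \<sigma> \<sigma>]
      by (simp add: algebra_simps)
    then show ?thesis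
      using that unfolding quot_def times_divide_eq_right add_divide_distrib[symmetric]
      by (intro divide_right_mono) auto
  qed
  then show "\<forall>\<^sub>F \<sigma> in at_right 0.
      quot u (\<lambda>x. (1 - s) * v x + s * w x) \<sigma> \<le> (1 - s) * quot u v \<sigma> + s * quot u w \<sigma>"
    by (auto simp: eventually_at_filter)
qed simp

text \<open>
  The left-hand side is the left slope in direction \<open>v\<close>. The comparison is convexity of the right
  slope in its direction, at the midpoint 0 of \<open>v\<close> and \<open>-v\<close>, where the right slope vanishes.
\<close>

lemma right_slope_uminus_ge:
  assumes "u \<in> D" "v \<in> D"
  shows "- right_slope u (\<lambda>x. - v x) \<le> right_slope u v"
proof -
  have zero: "(\<lambda>x. 0) \<in> D" using scale_mem[OF assms(1), of 0] by simp
  have "right_slope u (\<lambda>x. 0) = 0"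
    by (rule right_slope_eqI[where g = "\<lambda>_. 0"]) (simp_all add: assms zero quot_def)
  then show ?thesis
    using right_slope_convex[OF assms uminus_mem[OF assms(2)], of "1 / 2"] by simp
qed

end


section \<open>Slopes of a 2-homogeneous convex functional\<close>

lemma L2_space_add:
  assumes "u \<in> L2_space M" "v \<in> L2_space M"
  shows "(\<lambda>x. u x + v x) \<in> L2_space M"
proof -
  have [measurable]: "u \<in> borel_measurable M" "v \<in> borel_measurable M"
    using assms by (auto simp: L2_space_def)
  have "integrable M (\<lambda>x. 2 * (u x)\<^sup>2 + 2 * (v x)\<^sup>2)"
    using assms by (auto simp: L2_space_def)
  then have "integrable M (\<lambda>x. (u x + v x)\<^sup>2)"
  proof (rule Bochner_Integration.integrable_bound)
    have "(u x + v x)\<^sup>2 \<le> 2 * (u x)\<^sup>2 + 2 * (v x)\<^sup>2" for x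
      using sum_squares_bound[of "u x" "v x"] by (simp add: power2_sum)
    then show "AE x in M. norm ((u x + v x)\<^sup>2) \<le> norm (2 * (u x)\<^sup>2 + 2 * (v x)\<^sup>2)"
      by auto
  qed simp
  then show ?thesis by (simp add: L2_space_def)
qed

lemma L2_space_scale: "u \<in> L2_space M \<Longrightarrow> (\<lambda>x. c * u x) \<in> L2_space M"
  by (auto simp: L2_space_def power_mult_distrib)

lemma eff_domain_scale:
  assumes "two_homogeneous M E" "u \<in> eff_domain M E"
  shows "(\<lambda>x. c * u x) \<in> eff_domain M E"
  using assms by (auto simp: eff_domain_def two_homogeneous_def L2_space_scale ennreal_mult_eq_top_iff)

lemma eff_domain_convex:
  assumes "convex_functional M E" "u \<in> eff_domain M E" "v \<in> eff_domain M E" "s \<in> {0..1}"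
  shows "(\<lambda>x. (1 - s) * u x + s * v x) \<in> eff_domain M E"
proof -
  have "E (\<lambda>x. (1 - s) * u x + s * v x) \<le> ennreal (1 - s) * E u + ennreal s * E v"
    using assms by (auto simp: convex_functional_def eff_domain_def)
  also have "\<dots> < \<infinity>"
    using assms(2,3) by (auto simp: eff_domain_def ennreal_mult_less_top less_top)
  finally show ?thesis
    using assms(2,3) by (auto simp: eff_domain_def L2_space_add L2_space_scale)
qed

lemma convex_two_homogeneous_enn2real:
  assumes "convex_functional M E" "two_homogeneous M E"
  shows "convex_two_homogeneous (eff_domain M E) (\<lambda>u. enn2real (E u))"
proof
  fix u v :: "'a \<Rightarrow> real" and c s :: real
  assume u: "u \<in> eff_domain M E"
  show "(\<lambda>x. c * u x) \<in> eff_domain M E"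
    by (rule eff_domain_scale[OF assms(2) u])
  show "enn2real (E (\<lambda>x. c * u x)) = c\<^sup>2 * enn2real (E u)"
    using assms(2) u by (simp add: two_homogeneous_def eff_domain_def enn2real_mult)
  assume v: "v \<in> eff_domain M E"
  \<comment> \<open>The sum is twice the midpoint.\<close>
  show "(\<lambda>x. u x + v x) \<in> eff_domain M E"
    using eff_domain_scale[OF assms(2) eff_domain_convex[OF assms(1) u v, of "1 / 2"], of 2] by simp
  assume s: "0 \<le> s" "s \<le> 1"
  have fin: "E u < top" "E v < top"
    using u v by (auto simp: eff_domain_def less_top)
  have "E (\<lambda>x. (1 - s) * u x + s * v x) \<le> ennreal (1 - s) * E u + ennreal s * E v"
    using assms(1) u v s by (auto simp: convex_functional_def eff_domain_def)
  then have "enn2real (E (\<lambda>x. (1 - s) * u x + s * v x)) \<le>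
      enn2real (ennreal (1 - s) * E u + ennreal s * E v)"
    using fin by (intro enn2real_mono) (auto simp: ennreal_mult_less_top)
  also have "\<dots> = (1 - s) * enn2real (E u) + s * enn2real (E v)"
    using fin s by (simp add: enn2real_plus enn2real_mult ennreal_mult_less_top)
  finally show "enn2real (E (\<lambda>x. (1 - s) * u x + s * v x)) \<le>
      (1 - s) * enn2real (E u) + s * enn2real (E v)" .
qed simp

lemma enn2ereal_eq_ereal_enn2real: "a \<noteq> top \<Longrightarrow> enn2ereal a = ereal (enn2real a)"
  by (cases a) (auto simp: enn2ereal_ennreal)

locale convex_two_homogeneous_functional =
  fixes M :: "'a measure" and E :: "('a \<Rightarrow> real) \<Rightarrow> ennreal"
  assumes convex_functional: "convex_functional M E"
    and two_homogeneous: "two_homogeneous M E"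
begin

sublocale convex_two_homogeneous "eff_domain M E" "\<lambda>u. enn2real (E u)"
  by (rule convex_two_homogeneous_enn2real[OF convex_functional two_homogeneous])

lemma diff_quotient_eq_quot:
  assumes "u \<in> eff_domain M E" "v \<in> eff_domain M E" "\<sigma> \<noteq> 0"
  shows "diff_quotient E u v \<sigma> = ereal (quot u v \<sigma>)"
  using assms line_mem[OF assms(1,2), of \<sigma>]
  by (simp add: diff_quotient_def quot_def eff_domain_def enn2ereal_eq_ereal_enn2real)

lemma diff_quotient_tendsto_right:
  assumes "u \<in> eff_domain M E" "v \<in> eff_domain M E"
  shows "(diff_quotient E u v \<longlongrightarrow> ereal (right_slope u v)) (at_right 0)"
proof (rule Lim_transform_eventually)
  show "((\<lambda>\<sigma>. ereal (quot u v \<sigma>)) \<longlongrightarrow> ereal (right_slope u v)) (at_right 0)"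
    using quot_tendsto[OF assms] by simp
qed (auto simp: eventually_at_filter diff_quotient_eq_quot assms)

lemma diff_quotient_tendsto_left:
  assumes "u \<in> eff_domain M E" "v \<in> eff_domain M E"
  shows "(diff_quotient E u v \<longlongrightarrow> ereal (- right_slope u (\<lambda>x. - v x))) (at_left 0)"
  unfolding filterlim_at_left_to_right[where a = 0] minus_zero
proof (rule Lim_transform_eventually)
  show "((\<lambda>\<sigma>. ereal (- quot u (\<lambda>x. - v x) \<sigma>)) \<longlongrightarrow> ereal (- right_slope u (\<lambda>x. - v x))) (at_right 0)"
    using tendsto_minus[OF quot_tendsto[OF assms(1) uminus_mem[OF assms(2)]]] by simp
  have "- quot u (\<lambda>x. - v x) \<sigma> = quot u v (- \<sigma>)" for \<sigma>
    by (simp add: quot_def)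
  then show "\<forall>\<^sub>F \<sigma> in at_right 0. ereal (- quot u (\<lambda>x. - v x) \<sigma>) = diff_quotient E u v (- \<sigma>)"
    by (auto simp: eventually_at_filter diff_quotient_eq_quot assms)
qed

lemma slope_plus_eq:
  "u \<in> eff_domain M E \<Longrightarrow> v \<in> eff_domain M E \<Longrightarrow> slope_plus E u v = ereal (right_slope u v)"
  unfolding slope_plus_def by (intro tendsto_Lim diff_quotient_tendsto_right) auto

lemma slope_minus_eq:
  "u \<in> eff_domain M E \<Longrightarrow> v \<in> eff_domain M E \<Longrightarrow>
    slope_minus E u v = ereal (- right_slope u (\<lambda>x. - v x))"
  unfolding slope_minus_def by (intro tendsto_Lim diff_quotient_tendsto_left) auto

text \<open>
  If \<open>u\<close> is constant on the support of \<open>v\<close>, it is so on the support of \<open>\<sigma> v\<close>. Locality then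
  gives \<open>E (u + \<sigma> v) - E u = \<sigma>\<^sup>2 E v\<close>, which is of second order in \<open>\<sigma>\<close>.
\<close>

lemma right_slope_local:
  assumes loc: "local_functional M E" and u: "u \<in> eff_domain M E" and v: "v \<in> eff_domain M E"
    and const: "constant_on_supp M u v"
  shows "right_slope u v = 0"
proof (rule right_slope_eqI[OF u v])
  have "((\<lambda>\<sigma>. \<sigma> * enn2real (E v)) \<longlongrightarrow> 0 * enn2real (E v)) (at_right 0)"
    by (intro tendsto_intros)
  then show "((\<lambda>\<sigma>. \<sigma> * enn2real (E v)) \<longlongrightarrow> 0) (at_right 0)" by simp
  fix \<sigma> :: real assume \<sigma>: "0 < \<sigma>"
  have \<sigma>v: "(\<lambda>x. \<sigma> * v x) \<in> eff_domain M E" by (rule scale_mem[OF v])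
  have "constant_on_supp M u (\<lambda>x. \<sigma> * v x)"
    using const \<sigma> by (simp add: constant_on_supp_def)
  then have "E (\<lambda>x. u x + \<sigma> * v x) = E u + E (\<lambda>x. \<sigma> * v x)"
    using loc u \<sigma>v by (simp add: local_functional_def)
  then have "enn2real (E (\<lambda>x. u x + \<sigma> * v x)) = enn2real (E u) + \<sigma>\<^sup>2 * enn2real (E v)"
    using u \<sigma>v hom[OF v, of \<sigma>] by (simp add: eff_domain_def enn2real_plus less_top)
  then show "quot u v \<sigma> = \<sigma> * enn2real (E v)"
    using \<sigma> by (simp add: quot_def power2_eq_square)
qed

end


section \<open>Slopes of 2-homogeneous nonlinear Dirichlet forms\<close>

theorem theorem5p1:
  fixes M :: "'a measure" and E :: "('a \<Rightarrow> real) \<Rightarrow> ennreal"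
  assumes "sigma_finite_measure M"
    and "borel_correspondence M"
    and "nonlinear_dirichlet_form M E"
    and "two_homogeneous M E"
  shows
    \<comment> \<open>the limits defining the slopes exist\<close>
    "(\<forall>u\<in>eff_domain M E. \<forall>v\<in>eff_domain M E.
        (diff_quotient E u v \<longlongrightarrow> slope_plus E u v) (at_right 0) \<and>
        (diff_quotient E u v \<longlongrightarrow> slope_minus E u v) (at_left 0))
     \<and>
     \<comment> \<open>1\<close>
     (\<forall>L\<in>{slope_plus E, slope_minus E}.
        (\<forall>u\<in>eff_domain M E. \<forall>v\<in>eff_domain M E.
           \<bar>L u v\<bar> \<noteq> \<infinity> \<and>
           \<bar>L u v\<bar> \<le> ereal (2 * sqrt (enn2real (E u)) * sqrt (enn2real (E v)))) \<and>
        (\<forall>u\<in>eff_domain M E.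
           \<bar>L u u\<bar> = ereal (2 * sqrt (enn2real (E u)) * sqrt (enn2real (E u)))))
     \<and>
     (\<forall>u\<in>eff_domain M E. \<forall>v\<in>eff_domain M E. slope_minus E u v \<le> slope_plus E u v)
     \<and>
     \<comment> \<open>2\<close>
     (\<forall>L\<in>{slope_plus E, slope_minus E}. \<forall>u\<in>eff_domain M E.
        L u u = 2 * enn2ereal (E u))
     \<and>
     \<comment> \<open>3\<close>
     (\<forall>u\<in>eff_domain M E.
        (\<forall>L\<in>{slope_plus E, slope_minus E}. pos_homogeneous_on (eff_domain M E) (L u)) \<and>
        ereal_convex_on (eff_domain M E) (slope_plus E u) \<and>
        ereal_concave_on (eff_domain M E) (slope_minus E u))
     \<and>
     \<comment> \<open>4\<close>
     (\<forall>L\<in>{slope_plus E, slope_minus E}. \<forall>v\<in>eff_domain M E.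
        pos_homogeneous_on (eff_domain M E) (\<lambda>u. L u v))
     \<and>
     \<comment> \<open>5\<close>
     (\<forall>u\<in>eff_domain M E. \<forall>v\<in>eff_domain M E.
        slope_plus E u (\<lambda>x. - v x) = - slope_minus E u v)
     \<and>
     \<comment> \<open>6\<close>
     (local_functional M E \<longrightarrow>
        (\<forall>L\<in>{slope_plus E, slope_minus E}.
           \<forall>u\<in>eff_domain M E. \<forall>v\<in>eff_domain M E.
             constant_on_supp M u v \<longrightarrow> L u v = 0))"
proof -
  interpret convex_two_homogeneous_functional M E
    using assms(3,4) by unfold_locales (simp add: nonlinear_dirichlet_form_def)
  let ?D = "eff_domain M E"
  have fin: "enn2ereal (E u) = ereal (enn2real (E u))" if "u \<in> ?D" for u
    using that by (simp add: eff_domain_def enn2ereal_eq_ereal_enn2real)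
  have minus_bound: "\<bar>right_slope u (\<lambda>x. - v x)\<bar> \<le>
      2 * sqrt (enn2real (E u)) * sqrt (enn2real (E v))" if "u \<in> ?D" "v \<in> ?D" for u v
    using abs_right_slope_le[OF that(1) uminus_mem[OF that(2)]] that by (simp add: f_uminus)
  have minus_scale_direction: "right_slope u (\<lambda>x. - (c * v x)) = c * right_slope u (\<lambda>x. - v x)"
    if "u \<in> ?D" "v \<in> ?D" "0 < c" for u v c
    using right_slope_scale_direction[OF that(1) uminus_mem[OF that(2)] that(3)] by simp
  have minus_convex: "right_slope u (\<lambda>x. - ((1 - s) * v x + s * w x)) \<le>
      (1 - s) * right_slope u (\<lambda>x. - v x) + s * right_slope u (\<lambda>x. - w x)"
    if "u \<in> ?D" "v \<in> ?D" "w \<in> ?D" "0 \<le> s" "s \<le> 1" for u v w s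
    using right_slope_convex[OF that(1) uminus_mem[OF that(2)] uminus_mem[OF that(3)] that(4,5)]
    by (simp add: algebra_simps)
  have const_uminus: "constant_on_supp M u (\<lambda>x. - v x)" if "constant_on_supp M u v" for u v
    using that by (simp add: constant_on_supp_def)
  have comb_mem: "(\<lambda>x. (1 - s) * v x + s * w x) \<in> ?D" if "v \<in> ?D" "w \<in> ?D" for v w s
    by (intro add_mem scale_mem that)
  show ?thesis
  proof (intro conjI ballI impI)
    fix u v assume uv: "u \<in> ?D" "v \<in> ?D"
    show "(diff_quotient E u v \<longlongrightarrow> slope_plus E u v) (at_right 0)"
      using diff_quotient_tendsto_right[OF uv] by (simp add: slope_plus_eq uv)
    show "(diff_quotient E u v \<longlongrightarrow> slope_minus E u v) (at_left 0)"
      using diff_quotient_tendsto_left[OF uv] by (simp add: slope_minus_eq uv)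
    show "slope_minus E u v \<le> slope_plus E u v"
      using right_slope_uminus_ge[OF uv] by (simp add: slope_plus_eq slope_minus_eq uv)
    show "slope_plus E u (\<lambda>x. - v x) = - slope_minus E u v"
      by (simp add: slope_plus_eq slope_minus_eq uv uminus_mem)
  next
    fix L u v assume L: "L \<in> {slope_plus E, slope_minus E}" and uv: "u \<in> ?D" "v \<in> ?D"
    show "\<bar>L u v\<bar> \<noteq> \<infinity>"
      using L by (auto simp: slope_plus_eq slope_minus_eq uv)
    show "\<bar>L u v\<bar> \<le> ereal (2 * sqrt (enn2real (E u)) * sqrt (enn2real (E v)))"
      using L abs_right_slope_le[OF uv] minus_bound[OF uv]
      by (auto simp: slope_plus_eq slope_minus_eq uv)
  next
    fix L u assume L: "L \<in> {slope_plus E, slope_minus E}" and u: "u \<in> ?D"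
    have self: "L u u = ereal (2 * enn2real (E u))"
      using L by (auto simp: slope_plus_eq slope_minus_eq u right_slope_self right_slope_uminus_self)
    then show "\<bar>L u u\<bar> = ereal (2 * sqrt (enn2real (E u)) * sqrt (enn2real (E u)))"
      by simp
    show "L u u = 2 * enn2ereal (E u)"
      by (simp add: self fin[OF u])
  next
    fix L u assume L: "L \<in> {slope_plus E, slope_minus E}" and u: "u \<in> ?D"
    show "pos_homogeneous_on ?D (L u)"
      using L by (auto simp: pos_homogeneous_on_def slope_plus_eq slope_minus_eq u scale_mem
          right_slope_scale_direction minus_scale_direction)
    show "pos_homogeneous_on ?D (\<lambda>w. L w u)"
      using L by (auto simp: pos_homogeneous_on_def slope_plus_eq slope_minus_eq u scale_mem
          right_slope_scale_point uminus_mem)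
  next
    fix u assume u: "u \<in> ?D"
    show "ereal_convex_on ?D (slope_plus E u)"
      using right_slope_convex[OF u]
      by (auto simp: ereal_convex_on_def slope_plus_eq u comb_mem)
    show "ereal_concave_on ?D (slope_minus E u)"
      unfolding ereal_concave_on_def
    proof (intro ballI)
      fix v w and s :: real assume v: "v \<in> ?D" and w: "w \<in> ?D" and s: "s \<in> {0..1}"
      show "ereal (1 - s) * slope_minus E u v + ereal s * slope_minus E u w
          \<le> slope_minus E u (\<lambda>x. (1 - s) * v x + s * w x)"
        using minus_convex[OF u v w, of s] s by (simp add: slope_minus_eq u v w comb_mem)
    qed
  next
    fix L u v assume loc: "local_functional M E" and L: "L \<in> {slope_plus E, slope_minus E}"
      and uv: "u \<in> ?D" "v \<in> ?D" and const: "constant_on_supp M u v"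
    show "L u v = 0"
      using L right_slope_local[OF loc uv const]
        right_slope_local[OF loc uv(1) uminus_mem[OF uv(2)] const_uminus[OF const]]
      by (auto simp: slope_plus_eq slope_minus_eq uv)
  qed
qed

end
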